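(* For every integer $m\ge 3$ with $m\ne 7$ there exists a required permutation $\Pi_m$ of $[1,m]$, and for $m=7$ no required permutation exists. Explicitly: for every integer $m\ge 3$ with $m\neq 7$ there exist a permutation $(a_1,a_2,\dots,a_m)$ of the integers $1,2,\dots,m$ and integers $x\ne y$ such that, with the convention $a_0=a_{m+1}=0$, one has $a_{i-1}+a_i+a_{i+1}=x$ for every $i\in\{1,\dots,m\}$ with $i\equiv 1\pmod 4$, and $a_{j-1}+a_j+a_{j+1}=y$ for every $j\in\{1,\dots,m\}$ with $j\equiv 3\pmod 4$. For $m=7$ no such permutation and integers $x\ne y$ exist.
   Context: For $m\ge 2$, $[1,m]$ denotes the set of integers from $1$ to $m$. For $m\ge 3$, a required $\Pi_m$ is a permutation (linear arrangement) $a_1,a_2,\dots,a_m$ of the integers in $[1,m]$ such that, counting positions from left to right, for every integer in a position $i\equiv 1\pmod 4$ the sum of that integer and its adjacent integer(s) in the sequence equals a constant $x$, and for every integer in a position $j\equiv 3\pmod 4$ the sum of that integer and its adjacent integer(s) equals a constant $y$, with $x\ne y$. An integer in the first or last position has only one adjacent integer; the arrangement is linear, not cyclic. *)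

theory Defs
  imports Complex_Main "HOL-Number_Theory.Cong"
begin

text \<open>
  A linear arrangement \<open>a\<^sub>1, \<dots>, a\<^sub>m\<close> is a function \<open>a\<close> of which only the values
  at the positions in \<open>{1..m}\<close> matter.  The \<open>if\<close>s realise the convention
  \<open>a\<^sub>0 = a\<^sub>m\<^sub>+\<^sub>1 = 0\<close>: the first and last positions have one neighbour only.
\<close>

definition nbhd_sum :: "nat \<Rightarrow> (nat \<Rightarrow> int) \<Rightarrow> nat \<Rightarrow> int" where
  "nbhd_sum m a i =
     (if 1 < i then a (i - 1) else 0) + a i + (if i < m then a (i + 1) else 0)"

definition required_perm :: "nat \<Rightarrow> (nat \<Rightarrow> int) \<Rightarrow> bool" where
  "required_perm m a \<longleftrightarrow>
     bij_betw a {1..m} {1..int m} \<and>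
     (\<exists>x y :: int. x \<noteq> y \<and>
        (\<forall>i\<in>{1..m}. [i = 1] (mod 4) \<longrightarrow> nbhd_sum m a i = x) \<and>
        (\<forall>j\<in>{1..m}. [j = 3] (mod 4) \<longrightarrow> nbhd_sum m a j = y))"

end

theory Submission
  imports Defs
begin

text \<open>
  The integers in the even positions determine the arrangement, since \<open>x\<close> and \<open>y\<close> then give
  those in the odd positions; what has to be arranged is that all of \<open>1, \<dots>, m\<close> occur.
  Write \<open>d\<^sub>i\<close> and \<open>e\<^sub>i\<close> for the integers in positions \<open>4i - 2\<close> and \<open>4i\<close>.  If \<open>y = x + 2\<close> and both
  \<open>d\<close> and \<open>e\<close> increase by one, then positions \<open>4i - 3\<close> and \<open>4i - 1\<close> hold consecutive integers,
  and these pairs descend in steps of two, so every run of this kind fills three intervals.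
  For even \<open>m\<close> a single run (with \<open>y = x - 2\<close> if \<open>m \<equiv> 2\<close> modulo \<open>4\<close>) suffices.  For \<open>m\<close> congruent
  to \<open>1\<close>, \<open>5\<close> or \<open>7\<close> modulo \<open>8\<close>, two long runs cover all but boundedly many integers, which are
  placed at a few exceptional indices \<open>i\<close>.  For \<open>m \<equiv> 3\<close> modulo \<open>8\<close> the sequence \<open>d\<close> wraps around once,
  halfway, which makes each descending sequence switch to the other parity class
  of its interval.  The exceptional patterns were found by computer search.
\<close>

section \<open>Arrangements determined by their even positions\<close>

text \<open>By counting, \<open>m\<close> positions that cover \<open>m\<close> values cannot repeat
  one; so only the occurrence of every value has to be shown later.\<close>

lemma bij_betw_if_covers:
  fixes a :: "nat \<Rightarrow> int"
  assumes sub: "{1..int m} \<subseteq> a ` {1..m}"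
  shows "bij_betw a {1..m} {1..int m}"
proof -
  have "card (a ` {1..m}) \<le> card {1..int m}"
    using card_image_le[of "{1..m}" a] by simp
  then have img: "a ` {1..m} = {1..int m}"
    using card_seteq[OF _ sub] by simp
  then have "inj_on a {1..m}"
    by (simp add: inj_on_iff_eq_card)
  with img show ?thesis
    by (simp add: bij_betw_def)
qed

text \<open>Each odd position holds \<open>x\<close> or \<open>y\<close> minus its two neighbours,
  which builds the required sums in. Integer indices allow shifts without truncated
  subtraction.\<close>

definition arrangement :: "(int \<Rightarrow> int) \<Rightarrow> (int \<Rightarrow> int) \<Rightarrow> int \<Rightarrow> int \<Rightarrow> nat \<Rightarrow> int" where
  "arrangement e d x y p =
     (let t = int (p div 4) in
      if p mod 4 = 0 then e t
      else if p mod 4 = 1 then x - e t - d (t + 1)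
      else if p mod 4 = 2 then d (t + 1)
      else y - d (t + 1) - e (t + 1))"

lemma arrangement_simps:
  "arrangement e d x y (4 * t) = e (int t)"
  "arrangement e d x y (4 * t + 1) = x - e (int t) - d (int t + 1)"
  "arrangement e d x y (4 * t + 2) = d (int t + 1)"
  "arrangement e d x y (4 * t + 3) = y - d (int t + 1) - e (int t + 1)"
  by (simp_all add: arrangement_def Let_def div_mult_self1 del: add_Suc_right add_2_eq_Suc' One_nat_def)

text \<open>Index \<open>i\<close> stands for the block of positions \<open>4 * i - 3\<close> to
  \<open>4 * i\<close>; each upper bound keeps the position used within the arrangement.\<close>

inductive entry :: "nat \<Rightarrow> (int \<Rightarrow> int) \<Rightarrow> (int \<Rightarrow> int) \<Rightarrow> int \<Rightarrow> int \<Rightarrow> int \<Rightarrow> bool"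
  for m e d x y n where
  entry_e: "1 \<le> i \<Longrightarrow> 4 * i \<le> int m \<Longrightarrow> n = e i \<Longrightarrow> entry m e d x y n"
| entry_d: "1 \<le> i \<Longrightarrow> 4 * i - 2 \<le> int m \<Longrightarrow> n = d i \<Longrightarrow> entry m e d x y n"
| entry_x: "1 \<le> i \<Longrightarrow> 4 * i - 3 \<le> int m \<Longrightarrow> n = x - e (i - 1) - d i \<Longrightarrow> entry m e d x y n"
| entry_y: "1 \<le> i \<Longrightarrow> 4 * i - 1 \<le> int m \<Longrightarrow> n = y - d i - e i \<Longrightarrow> entry m e d x y n"

lemma entry_triple:
  assumes "1 \<le> i" "4 * i - 1 \<le> int m" "n \<in> {d i, x - e (i - 1) - d i, y - d i - e i}"
  shows "entry m e d x y n"
  using assms by (auto intro: entry_d[of i] entry_x[of i] entry_y[of i])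

text \<open>The formulas subtract two neighbours everywhere, so a neighbour missing at an end must
  be a zero of \<open>e\<close> or \<open>d\<close>; \<open>e0\<close>, \<open>d_end\<close> and
  \<open>e_end\<close> provide this.\<close>

lemma required_perm_arrangement:
  fixes e d :: "int \<Rightarrow> int"
  assumes "x \<noteq> y" and e0: "e 0 = 0"
    and d_end: "\<And>i. int m = 4 * i + 1 \<Longrightarrow> d (i + 1) = 0"
    and e_end: "\<And>i. int m = 4 * i + 3 \<Longrightarrow> e (i + 1) = 0"
    and cover: "\<And>n. 1 \<le> n \<Longrightarrow> n \<le> int m \<Longrightarrow> entry m e d x y n"
  shows "required_perm m (arrangement e d x y)"
proof -
  let ?a = "arrangement e d x y"
  note a_simps = arrangement_simps[of e d x y]
  have sub: "{1..int m} \<subseteq> ?a ` {1..m}"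
  proof
    fix n assume "n \<in> {1..int m}"
    then have "entry m e d x y n" using cover by simp
    then show "n \<in> ?a ` {1..m}"
    proof cases
      case (entry_e i)
      then show ?thesis
        using a_simps(1)[of "nat i"] by (intro image_eqI[of _ _ "4 * nat i"]) auto
    next
      case (entry_d i)
      then show ?thesis
        using a_simps(3)[of "nat (i - 1)"]
        by (intro image_eqI[of _ _ "4 * nat (i - 1) + 2"]) auto
    next
      case (entry_x i)
      then show ?thesis
        using a_simps(2)[of "nat (i - 1)"]
        by (intro image_eqI[of _ _ "4 * nat (i - 1) + 1"]) auto
    next
      case (entry_y i)
      then show ?thesis
        using a_simps(4)[of "nat (i - 1)"]
        by (intro image_eqI[of _ _ "4 * nat (i - 1) + 3"]) auto
    qed
  qed
  then have bij: "bij_betw ?a {1..m} {1..int m}" by (rule bij_betw_if_covers)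
  have sum_x: "nbhd_sum m ?a i = x" if "i \<in> {1..m}" "[i = 1] (mod 4)" for i
  proof -
    have "i mod 4 = 1" using that by (simp add: cong_def)
    then obtain t where i: "i = 4 * t + 1" by (metis mult_div_mod_eq)
    \<comment> \<open>The case \<open>i = m\<close> lacks a right neighbour; the split on
      \<open>t\<close> isolates position 1, where \<open>e0\<close> stands in for the left
      one.\<close>
    show ?thesis
    proof (cases "i = m")
      case True
      with i have "d (int t + 1) = 0" using d_end by simp
      then show ?thesis
        using True i a_simps(1)[of t] a_simps(2)[of t] e0
        by (cases t) (auto simp: nbhd_sum_def)
    next
      case False
      then show ?thesis
        using that i a_simps(1)[of t] a_simps(2)[of t] a_simps(3)[of t] e0
        by (cases t) (auto simp: nbhd_sum_def)
    qed
  qed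
  have sum_y: "nbhd_sum m ?a i = y" if "i \<in> {1..m}" "[i = 3] (mod 4)" for i
  proof -
    have "i mod 4 = 3" using that by (simp add: cong_def)
    then obtain t where i: "i = 4 * t + 3" by (metis mult_div_mod_eq)
    show ?thesis
    proof (cases "i = m")
      case True
      with i have "e (int t + 1) = 0" using e_end by simp
      then show ?thesis
        using True i a_simps(3)[of t] a_simps(4)[of t]
        by (auto simp: nbhd_sum_def numeral_eq_Suc ac_simps)
    next
      case False
      then show ?thesis
        using that i a_simps(3)[of t] a_simps(4)[of t] a_simps(1)[of "Suc t"]
        by (auto simp: nbhd_sum_def numeral_eq_Suc ac_simps)
    qed
  qed
  show ?thesis
    unfolding required_perm_def using bij sum_x sum_y \<open>x \<noteq> y\<close> by blast
qed

text \<open>At index \<open>i\<close> the odd positions hold \<open>x - u - s + 1 - 2 * i\<close>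
  and its successor, so the indices \<open>a\<close> to \<open>b\<close> tile an interval. The
  condition on \<open>e\<close> starts at \<open>a - 1\<close> because position
  \<open>4 * i - 3\<close> borders \<open>e (i - 1)\<close>.\<close>

lemma entry_descending_pairs:
  fixes a b s u x n :: int
  assumes d: "\<And>i. a \<le> i \<Longrightarrow> i \<le> b \<Longrightarrow> d i = i + s"
    and e: "\<And>i. a - 1 \<le> i \<Longrightarrow> i \<le> b \<Longrightarrow> e i = i + u"
    and "1 \<le> a" "4 * b - 1 \<le> int m"
    and n: "x - u - s + 1 - 2 * b \<le> n" "n \<le> x - u - s + 2 - 2 * a"
  shows "entry m e d x (x + 2) n"
proof -
  \<comment> \<open>The index of the pair containing \<open>n\<close>; rounding sends both members
    of a pair to the same index.\<close>
  define i where "i = (x - u - s + 2 - n) div 2"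
  have i: "a \<le> i" "i \<le> b" using n unfolding i_def by presburger+
  have "n = x - u - s + 1 - 2 * i \<or> n = x - u - s + 2 - 2 * i"
    unfolding i_def by presburger
  then show ?thesis
    using i d[of i] e[of i] e[of "i - 1"] assms(3,4) by (intro entry_triple[of i]) auto
qed

section \<open>Even lengths\<close>

lemma ex_required_perm_4k:
  fixes k :: int
  assumes m: "int m = 4 * k"
  shows "\<exists>a. required_perm m a"
proof -
  define e where "e = (\<lambda>i::int. i)"
  define d where "d = (\<lambda>i. 3 * k + i)"
  \<comment> \<open>This value places the descending pairs exactly between the values
    \<open>1\<close> to \<open>k\<close> of \<open>e\<close> and those of \<open>d\<close> above
    \<open>3 * k\<close>.\<close>
  define x where "x = 6 * k"
  have residue: "int m \<noteq> 4 * i + 1" "int m \<noteq> 4 * i + 3" for i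
    using assms by presburger+
  have "required_perm m (arrangement e d x (x + 2))"
  proof (rule required_perm_arrangement)
    fix n assume n: "1 \<le> n" "n \<le> int m"
    consider "n \<le> k"
      | "k < n" "n \<le> 3 * k"
      | "3 * k < n"
      using n assms by (smt (verit) insert_iff)
    then show "entry m e d x (x + 2) n"
    proof cases
      case 1
      show ?thesis
        by (rule entry_e[of n])
          (use 1 n assms in \<open>auto simp: d_def e_def x_def\<close>)
    next
      case 2
      show ?thesis
        by (rule entry_descending_pairs[where a = 1 and b = k and s = "3 * k" and u = 0])
          (use 2 n assms in \<open>auto simp: d_def e_def x_def\<close>)
    next
      case 3
      show ?thesis
        by (rule entry_d[of "n - 3 * k"])
          (use 3 n assms in \<open>auto simp: d_def e_def x_def\<close>)
    qed
  qed (use residue assms in \<open>auto simp: d_def e_def x_def\<close>)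
  then show ?thesis by blast
qed

text \<open>The jump from \<open>e 0 = 0\<close> to \<open>e 1 = 2 * k + 1\<close> lifts the integer
  in position 1 to the maximum \<open>4 * k + 2\<close>. The consecutive pairs now sit in positions
  \<open>4 * i - 1\<close> and \<open>4 * i + 1\<close>, whence \<open>y = x - 2\<close>.\<close>

lemma ex_required_perm_4k_2:
  fixes k :: int
  assumes m: "int m = 4 * k + 2" and "1 \<le> k"
  shows "\<exists>a. required_perm m a"
proof -
  define e where "e = (\<lambda>i. if i = 0 then 0 else 2 * k + i)"
  define d where "d = (\<lambda>i. 3 * k + i)"
  define x where "x = 7 * k + 3"
  have residue: "int m \<noteq> 4 * i + 1" "int m \<noteq> 4 * i + 3" for i
    using assms by presburger+
  have "required_perm m (arrangement e d x (x - 2))"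
  proof (rule required_perm_arrangement)
    fix n assume n: "1 \<le> n" "n \<le> int m"
    consider "n = 4 * k + 2"
      | "n \<le> 2 * k" "odd n"
      | "n \<le> 2 * k" "even n"
      | "2 * k < n" "n \<le> 3 * k"
      | "3 * k < n" "n \<le> 4 * k + 1"
      using n assms by (smt (verit) insert_iff)
    then show "entry m e d x (x - 2) n"
    proof cases
      case 1
      show ?thesis
        by (rule entry_x[of 1])
          (use 1 n assms in \<open>auto simp: d_def e_def x_def\<close>)
    next
      case 2
      show ?thesis
        by (rule entry_y[of "k - n div 2"])
          (use 2 n assms in \<open>auto simp: d_def e_def x_def elim!: evenE oddE\<close>)
    next
      case 3
      show ?thesis
        by (rule entry_x[of "k + 2 - n div 2"])
          (use 3 n assms in \<open>auto simp: d_def e_def x_def elim!: evenE oddE, presburger\<close>)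
    next
      case 4
      show ?thesis
        by (rule entry_e[of "n - 2 * k"])
          (use 4 n assms in \<open>auto simp: d_def e_def x_def\<close>)
    next
      case 5
      show ?thesis
        by (rule entry_d[of "n - 3 * k"])
          (use 5 n assms in \<open>auto simp: d_def e_def x_def\<close>)
    qed
  qed (use residue assms in \<open>auto simp: d_def e_def x_def\<close>)
  then show ?thesis by blast
qed

section \<open>Odd lengths\<close>

text \<open>Between the two runs \<open>d\<close> skips \<open>h + 1\<close> and
  \<open>h + 2\<close>; the exceptional index \<open>h + 2\<close> puts these two in odd positions.
  Index 1 and the last position fill the remaining gaps.\<close>

lemma ex_required_perm_8h_5:
  fixes h :: int
  assumes m: "int m = 8 * h + 5" and "1 \<le> h"
  shows "\<exists>a. required_perm m a"
proof -
  define k where "k = 2 * h + 1"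
  define e where "e = (\<lambda>i. if i = 0 then 0 else k + i)"
  \<comment> \<open>The final 0 serves \<open>d_end\<close>: the last position is
    \<open>4 * k + 1\<close>.\<close>
  define d where
    "d = (\<lambda>i. if i = 1 then 2 * k + 2
    else if i \<le> h + 1 then i - 1
    else if i = h + 2 then 3 * k + 1
    else if i \<le> k then i
    else 0)"
  define x where "x = 5 * k + 2"
  have residue: "int m \<noteq> 4 * i + 3" for i
    using assms unfolding k_def by presburger+
  have "required_perm m (arrangement e d x (x + 2))"
  proof (rule required_perm_arrangement)
    fix n assume n: "1 \<le> n" "n \<le> int m"
    consider "n \<le> h"
      | "h + 3 \<le> n" "n \<le> k"
      | "k < n" "n \<le> 2 * k"
      | "2 * k + 3 \<le> n" "n \<le> 3 * k - 1"
      | "3 * k + 3 \<le> n" "n \<le> 4 * k + 1"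
      | "n \<in> {2 * k + 1, 2 * k + 2, 3 * k}"
      | "n \<in> {h + 1, h + 2, 3 * k + 1}"
      | "n = 3 * k + 2"
      using n assms unfolding k_def by (smt (verit) insert_iff)
    then show "entry m e d x (x + 2) n"
    proof cases
      case 1
      show ?thesis
        by (rule entry_d[of "n + 1"])
          (use 1 n assms in \<open>auto simp: d_def e_def x_def k_def\<close>)
    next
      case 2
      show ?thesis
        by (rule entry_d[of n])
          (use 2 n assms in \<open>auto simp: d_def e_def x_def k_def\<close>)
    next
      case 3
      show ?thesis
        by (rule entry_e[of "n - k"])
          (use 3 n assms in \<open>auto simp: d_def e_def x_def k_def\<close>)
    next
      case 4
      show ?thesis
        by (rule entry_descending_pairs[where a = "h + 3" and b = "k" and s = 0 and u = k])
          (use 4 n assms in \<open>auto simp: d_def e_def x_def k_def\<close>)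
    next
      case 5
      show ?thesis
        by (rule entry_descending_pairs[where a = 2 and b = "h + 1" and s = "- 1" and u = k])
          (use 5 n assms in \<open>auto simp: d_def e_def x_def k_def\<close>)
    next
      case 6
      show ?thesis
        by (rule entry_triple[of 1])
          (use 6 n assms in \<open>auto simp: d_def e_def x_def k_def\<close>)
    next
      case 7
      show ?thesis
        by (rule entry_triple[of "h + 2"])
          (use 7 n assms in \<open>auto simp: d_def e_def x_def k_def\<close>)
    next
      case 8
      show ?thesis
        by (rule entry_x[of "k + 1"])
          (use 8 n assms in \<open>auto simp: d_def e_def x_def k_def\<close>)
    qed
  qed (use residue assms in \<open>auto simp: d_def e_def x_def k_def\<close>)
  then show ?thesis by blast
qed

text \<open>For \<open>i\<close> from 2 to \<open>k\<close> the step of \<open>e\<close> is one, so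
  any choice of \<open>d i\<close> gives consecutive integers in the odd positions of its block. The
  bound on \<open>h\<close> keeps the exceptional indices 1, 2, \<open>h + 2\<close>,
  \<open>h + 3\<close> and \<open>k\<close> distinct.\<close>

lemma ex_required_perm_8h_1:
  fixes h :: int
  assumes m: "int m = 8 * h + 1" and "4 \<le> h"
  shows "\<exists>a. required_perm m a"
proof -
  define k where "k = 2 * h"
  define e where "e = (\<lambda>i. if i = 0 then 0 else 3 * k + i)"
  define d where
    "d = (\<lambda>i. if i = 1 then 2 * k + 1
    else if i = 2 then k + 4
    else if i \<le> h + 1 then i - 2
    else if i \<le> h + 3 then i + 3 * h - 3
    else if i < k then i
    else if i = k then k + 3
    else 0)"
  define x where "x = 6 * k + 2"
  have residue: "int m \<noteq> 4 * i + 3" for i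
    using assms unfolding k_def by presburger+
  have "required_perm m (arrangement e d x (x + 2))"
  proof (rule required_perm_arrangement)
    fix n assume n: "1 \<le> n" "n \<le> int m"
    consider "n \<le> h - 1"
      | "h + 4 \<le> n" "n \<le> k - 1"
      | "k + 5 \<le> n" "n \<le> 2 * k - 4"
      | "2 * k + 3 \<le> n" "n \<le> 3 * k"
      | "3 * k < n" "n \<le> 4 * k"
      | "n \<in> {k + 2, 2 * k + 1, 4 * k + 1}"
      | "n \<in> {k + 4, 2 * k - 3, 2 * k - 2}"
      | "n \<in> {h + 2, h + 3, 2 * k - 1}"
      | "n \<in> {h, h + 1, 2 * k}"
      | "n \<in> {k, k + 1, k + 3}"
      | "n = 2 * k + 2"
      using n assms unfolding k_def by (smt (verit) insert_iff)
    then show "entry m e d x (x + 2) n"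
    proof cases
      case 1
      show ?thesis
        by (rule entry_d[of "n + 2"])
          (use 1 n assms in \<open>auto simp: d_def e_def x_def k_def\<close>)
    next
      case 2
      show ?thesis
        by (rule entry_d[of n])
          (use 2 n assms in \<open>auto simp: d_def e_def x_def k_def\<close>)
    next
      case 3
      show ?thesis
        by (rule entry_descending_pairs[where a = "h + 4" and b = "k - 1" and s = 0 and u = "3 * k"])
          (use 3 n assms in \<open>auto simp: d_def e_def x_def k_def\<close>)
    next
      case 4
      show ?thesis
        by (rule entry_descending_pairs[where a = 3 and b = "h + 1" and s = "- 2" and u = "3 * k"])
          (use 4 n assms in \<open>auto simp: d_def e_def x_def k_def\<close>)
    next
      case 5
      show ?thesis
        by (rule entry_e[of "n - 3 * k"])
          (use 5 n assms in \<open>auto simp: d_def e_def x_def k_def\<close>)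
    next
      case 6
      show ?thesis
        by (rule entry_triple[of 1])
          (use 6 n assms in \<open>auto simp: d_def e_def x_def k_def\<close>)
    next
      case 7
      show ?thesis
        by (rule entry_triple[of 2])
          (use 7 n assms in \<open>auto simp: d_def e_def x_def k_def\<close>)
    next
      case 8
      show ?thesis
        by (rule entry_triple[of "h + 2"])
          (use 8 n assms in \<open>auto simp: d_def e_def x_def k_def\<close>)
    next
      case 9
      show ?thesis
        by (rule entry_triple[of "h + 3"])
          (use 9 n assms in \<open>auto simp: d_def e_def x_def k_def\<close>)
    next
      case 10
      show ?thesis
        by (rule entry_triple[of k])
          (use 10 n assms in \<open>auto simp: d_def e_def x_def k_def\<close>)
    next
      case 11
      show ?thesis
        by (rule entry_x[of "k + 1"])
          (use 11 n assms in \<open>auto simp: d_def e_def x_def k_def\<close>)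
    qed
  qed (use residue assms in \<open>auto simp: d_def e_def x_def k_def\<close>)
  then show ?thesis by blast
qed

text \<open>At \<open>h + 1\<close>, \<open>d\<close> drops to \<open>4 * h + 2\<close> instead of
  reaching \<open>6 * h + 3\<close>; the odd difference is what switches parity. The zero of
  \<open>e\<close> at \<open>2 * h + 1\<close> serves \<open>e_end\<close> and brings
  \<open>8 * h + 3\<close> into the last position.\<close>

lemma ex_required_perm_8h_3:
  fixes h :: int
  assumes m: "int m = 8 * h + 3"
  shows "\<exists>a. required_perm m a"
proof -
  define e where "e = (\<lambda>i. if i \<le> 2 * h then i else 0)"
  define d where "d = (\<lambda>i. if i \<le> h then 5 * h + 2 + i else 3 * h + 1 + i)"
  define x where "x = 9 * h + 3"
  have residue: "int m \<noteq> 4 * i + 1" for i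
    using assms by presburger+
  have "required_perm m (arrangement e d x (13 * h + 5))"
  proof (rule required_perm_arrangement)
    fix n assume n: "1 \<le> n" "n \<le> int m"
    consider "n \<le> 2 * h"
      | "2 * h + 1 \<le> n" "n \<le> 4 * h + 1" "even n"
      | "2 * h + 1 \<le> n" "n \<le> 4 * h + 1" "odd n"
      | "4 * h + 2 \<le> n" "n \<le> 5 * h + 2"
      | "5 * h + 3 \<le> n" "n \<le> 6 * h + 2"
      | "6 * h + 3 \<le> n" "n \<le> 8 * h + 2" "odd n"
      | "6 * h + 3 \<le> n" "n \<le> 8 * h + 2" "even n"
      | "n = 8 * h + 3"
      using n assms by (smt (verit) insert_iff)
    then show "entry m e d x (13 * h + 5) n"
    proof cases
      case 1
      show ?thesis
        by (rule entry_e[of n])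
          (use 1 n assms in \<open>auto simp: d_def e_def x_def\<close>)
    next
      case 2
      \<comment> \<open>The index solves \<open>n = 4 * h + 2 - 2 * i\<close>, valid for
        \<open>i \<le> h\<close>; odd \<open>n\<close> come from the indices after the wrap.\<close>
      show ?thesis
        by (rule entry_x[of "2 * h + 1 - n div 2"])
          (use 2 n assms in \<open>auto simp: d_def e_def x_def elim!: evenE oddE\<close>)
    next
      case 3
      show ?thesis
        by (rule entry_x[of "3 * h + 1 - n div 2"])
          (use 3 n assms in \<open>auto simp: d_def e_def x_def elim!: evenE oddE\<close>)
    next
      case 4
      show ?thesis
        by (rule entry_d[of "n - 3 * h - 1"])
          (use 4 n assms in \<open>auto simp: d_def e_def x_def\<close>)
    next
      case 5
      show ?thesis
        by (rule entry_d[of "n - 5 * h - 2"])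
          (use 5 n assms in \<open>auto simp: d_def e_def x_def\<close>)
    next
      case 6
      show ?thesis
        by (rule entry_y[of "4 * h + 1 - n div 2"])
          (use 6 n assms in \<open>auto simp: d_def e_def x_def elim!: evenE oddE\<close>)
    next
      case 7
      show ?thesis
        by (rule entry_y[of "5 * h + 2 - n div 2"])
          (use 7 n assms in \<open>auto simp: d_def e_def x_def elim!: evenE oddE\<close>)
    next
      case 8
      show ?thesis
        by (rule entry_y[of "2 * h + 1"])
          (use 8 n assms in \<open>auto simp: d_def e_def x_def\<close>)
    qed
  qed (use residue assms in \<open>auto simp: d_def e_def x_def\<close>)
  then show ?thesis by blast
qed

text \<open>The bound on \<open>h\<close> keeps the eight exceptional indices distinct. Only at
  \<open>k + 1\<close>, where \<open>e\<close> returns to 0 for \<open>e_end\<close>, do the odd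
  positions of a block not hold consecutive integers.\<close>

lemma ex_required_perm_8h_7:
  fixes h :: int
  assumes m: "int m = 8 * h + 7" and "3 \<le> h"
  shows "\<exists>a. required_perm m a"
proof -
  define k where "k = 2 * h + 1"
  define e where "e = (\<lambda>i. if i \<le> k then i else 0)"
  define d where
    "d = (\<lambda>i. if i = 1 then 3 * k + 2
    else if i = 2 then 3 * k + 4
    else if i < h then k + 2 + i
    else if i = h then 3 * k + 9
    else if i = h + 1 then 3 * k + 6
    else if i = h + 2 then 3 * k + 3
    else if i < k - 1 then k + 5 + i
    else if i = k - 1 then 3 * k + 10
    else if i = k then k + 3
    else 3 * k + 5)"
  define x where "x = 5 * k + 9"
  have residue: "int m \<noteq> 4 * i + 1" for i
    using assms unfolding k_def by presburger+
  have "required_perm m (arrangement e d x (x + 2))"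
  proof (rule required_perm_arrangement)
    fix n assume n: "1 \<le> n" "n \<le> int m"
    consider "n \<le> k"
      | "k + 5 \<le> n" "n \<le> k + h + 1"
      | "k + h + 8 \<le> n" "n \<le> 2 * k + 3"
      | "2 * k + 9 \<le> n" "n \<le> 3 * k + 1"
      | "3 * k + 11 \<le> n" "n \<le> 4 * k + 3"
      | "n \<in> {3 * k + 2, 2 * k + 7, 2 * k + 8}"
      | "n \<in> {3 * k + 4, 2 * k + 4, 2 * k + 5}"
      | "n \<in> {3 * k + 9, k + h + 2, k + h + 3}"
      | "n \<in> {3 * k + 6, k + h + 4, k + h + 5}"
      | "n \<in> {3 * k + 3, k + h + 6, k + h + 7}"
      | "n \<in> {3 * k + 10, k + 1, k + 2}"
      | "n \<in> {k + 3, 3 * k + 7, 3 * k + 8}"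
      | "n \<in> {3 * k + 5, k + 4, 2 * k + 6}"
      using n assms unfolding k_def by (smt (verit) insert_iff)
    then show "entry m e d x (x + 2) n"
    proof cases
      case 1
      show ?thesis
        by (rule entry_e[of n])
          (use 1 n assms in \<open>auto simp: d_def e_def x_def k_def\<close>)
    next
      case 2
      show ?thesis
        by (rule entry_d[of "n - k - 2"])
          (use 2 n assms in \<open>auto simp: d_def e_def x_def k_def\<close>)
    next
      case 3
      show ?thesis
        by (rule entry_d[of "n - k - 5"])
          (use 3 n assms in \<open>auto simp: d_def e_def x_def k_def\<close>)
    next
      case 4
      show ?thesis
        by (rule entry_descending_pairs[where a = "h + 3" and b = "k - 2" and s = "k + 5" and u = 0])
          (use 4 n assms in \<open>auto simp: d_def e_def x_def k_def\<close>)
    next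
      case 5
      show ?thesis
        by (rule entry_descending_pairs[where a = 3 and b = "h - 1" and s = "k + 2" and u = 0])
          (use 5 n assms in \<open>auto simp: d_def e_def x_def k_def\<close>)
    next
      case 6
      show ?thesis
        by (rule entry_triple[of 1])
          (use 6 n assms in \<open>auto simp: d_def e_def x_def k_def\<close>)
    next
      case 7
      show ?thesis
        by (rule entry_triple[of 2])
          (use 7 n assms in \<open>auto simp: d_def e_def x_def k_def\<close>)
    next
      case 8
      show ?thesis
        by (rule entry_triple[of h])
          (use 8 n assms in \<open>auto simp: d_def e_def x_def k_def\<close>)
    next
      case 9
      show ?thesis
        by (rule entry_triple[of "h + 1"])
          (use 9 n assms in \<open>auto simp: d_def e_def x_def k_def\<close>)
    next
      case 10
      show ?thesis
        by (rule entry_triple[of "h + 2"])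
          (use 10 n assms in \<open>auto simp: d_def e_def x_def k_def\<close>)
    next
      case 11
      show ?thesis
        by (rule entry_triple[of "k - 1"])
          (use 11 n assms in \<open>auto simp: d_def e_def x_def k_def\<close>)
    next
      case 12
      show ?thesis
        by (rule entry_triple[of k])
          (use 12 n assms in \<open>auto simp: d_def e_def x_def k_def\<close>)
    next
      case 13
      show ?thesis
        by (rule entry_triple[of "k + 1"])
          (use 13 n assms in \<open>auto simp: d_def e_def x_def k_def\<close>)
    qed
  qed (use residue assms in \<open>auto simp: d_def e_def x_def k_def\<close>)
  then show ?thesis by blast
qed

section \<open>Small lengths by evaluation\<close>

text \<open>Quantifiers and inclusion range over explicit lists so that \<open>code_simp\<close> can
  evaluate the conditions.\<close>

lemma required_perm_nth:
  fixes xs :: "int list"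
  assumes "length xs = m" "x \<noteq> y" "set [1..int m] \<subseteq> set xs"
    and sums: "\<forall>i \<in> set [1..<Suc m]. odd i \<longrightarrow>
      nbhd_sum m (\<lambda>i. xs ! (i - 1)) i = (if i mod 4 = 1 then x else y)"
  shows "required_perm m (\<lambda>i. xs ! (i - 1))"
proof -
  have "{1..int m} \<subseteq> (\<lambda>i. xs ! (i - 1)) ` {1..m}"
  proof
    fix n assume "n \<in> {1..int m}"
    then have "n \<in> set xs" using assms(3) by auto
    then obtain j where "j < m" "xs ! j = n" using assms(1) by (auto simp: in_set_conv_nth)
    then show "n \<in> (\<lambda>i. xs ! (i - 1)) ` {1..m}" by (intro image_eqI[of _ _ "Suc j"]) auto
  qed
  then have "bij_betw (\<lambda>i. xs ! (i - 1)) {1..m} {1..int m}" by (rule bij_betw_if_covers)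
  moreover have "nbhd_sum m (\<lambda>i. xs ! (i - 1)) i = (if i mod 4 = 1 then x else y)"
    if "i \<in> {1..m}" "i mod 4 = 1 \<or> i mod 4 = 3" for i
  proof -
    have "odd i" using that(2) by presburger
    then show ?thesis using bspec[OF sums, of i] that(1) by (simp del: upt_Suc)
  qed
  ultimately show ?thesis
    unfolding required_perm_def cong_def using assms(2)
    by (intro conjI exI[of _ x] exI[of _ y]) simp_all
qed

text \<open>These are the lengths below the bounds on \<open>h\<close>: \<open>h = 0\<close> for
  \<open>8 * h + 5\<close>, \<open>h = 1, 2, 3\<close> for \<open>8 * h + 1\<close>, and
  \<open>h = 1, 2\<close> for \<open>8 * h + 7\<close>.\<close>

lemma ex_required_perm_small:
  assumes "m \<in> {5, 9, 15, 17, 23, 25}"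
  shows "\<exists>a. required_perm m a"
proof -
  have "required_perm 5 (\<lambda>i. [1, 4, 5, 3, 2] ! (i - 1))"
    by (rule required_perm_nth[where x = 5 and y = 12]) code_simp+
  moreover
  have "required_perm 9 (\<lambda>i. [6, 7, 1, 3, 8, 2, 5, 4, 9] ! (i - 1))"
    by (rule required_perm_nth[where x = 13 and y = 11]) code_simp+
  moreover
  have "required_perm 15 (\<lambda>i. [8, 13, 1, 5, 14, 2, 11, 6, 12, 3, 9, 7, 10, 4, 15] ! (i - 1))"
    by (rule required_perm_nth[where x = 21 and y = 19]) code_simp+
  moreover
  have "required_perm 17 (\<lambda>i. [9, 12, 10, 1, 15, 5, 16, 2, 13, 6, 14, 3, 7, 11, 8, 4, 17] ! (i - 1))"
    by (rule required_perm_nth[where x = 21 and y = 23]) code_simp+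
  moreover
  have "required_perm 23 (\<lambda>i. [15, 17, 16, 8, 5, 19,
      13, 9, 3, 20, 11, 10, 1, 21, 14, 6, 4, 22, 12, 7, 2, 23, 18] ! (i - 1))"
    by (rule required_perm_nth[where x = 32 and y = 41]) code_simp+
  moreover
  have "required_perm 25 (\<lambda>i. [17, 14, 18, 1, 23, 7, 24, 2, 21, 8,
      22, 3, 19, 9, 20, 4, 12, 15, 13, 5, 10, 16, 11, 6, 25] ! (i - 1))"
    by (rule required_perm_nth[where x = 31 and y = 33]) code_simp+
  ultimately show ?thesis using assms by blast
qed

section \<open>Impossibility for length 7\<close>

text \<open>Unlike implication, a conditional is evaluated lazily by \<open>code_simp\<close>,
  which prunes the search.  In \<open>seven_search\<close>, \<open>b\<^sub>j\<close> and \<open>c\<^sub>j\<close> are the integers in the positions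
  \<open>2j\<close> and \<open>2j - 1\<close>, with \<open>c\<^sub>3\<close> and \<open>c\<^sub>4\<close> eliminated.\<close>

lemma imp_iff_if: "(P \<longrightarrow> Q) \<longleftrightarrow> (if P then Q else True)"
  by simp

lemma seven_search:
  "\<forall>b1 \<in> set [1..7::int]. \<forall>c1 \<in> set [1..7]. c1 \<noteq> b1 \<longrightarrow>
    (\<forall>b2 \<in> set [1..7]. b2 \<noteq> b1 \<and> b2 \<noteq> c1 \<longrightarrow>
      (\<forall>b3 \<in> set [1..7].
        b2 + b3 < b1 + c1 \<and> b1 + c1 \<le> b2 + b3 + 7 \<and>
        distinct [b1, c1, b2, b3, b1 + c1 - b2 - b3] \<longrightarrow>
        (\<forall>c2 \<in> set [1..7].
          b3 < b1 + c2 + b2 \<and> b1 + c2 + b2 \<le> b3 + 7 \<and>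
          distinct [b1, c1, b2, b3, b1 + c1 - b2 - b3, c2, b1 + c2 + b2 - b3] \<longrightarrow> c1 = c2 + b2)))"
  unfolding imp_iff_if by code_simp

text \<open>The search forces \<open>a 1 = a 3 + a 4\<close>; adding \<open>a 2\<close> to both
  sides turns this into \<open>x = y\<close>.\<close>

lemma not_required_perm_7: "\<not> required_perm 7 a"
proof
  assume "required_perm 7 a"
  then obtain x y where bij: "bij_betw a {1..7} {1..7}" and "x \<noteq> y"
    and x: "\<And>i. i \<in> {1..7} \<Longrightarrow> [i = 1] (mod 4) \<Longrightarrow> nbhd_sum 7 a i = x"
    and y: "\<And>i. i \<in> {1..7} \<Longrightarrow> [i = 3] (mod 4) \<Longrightarrow> nbhd_sum 7 a i = y"
    unfolding required_perm_def by auto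
  have eqs: "a 1 + a 2 = x" "a 4 + a 5 + a 6 = x" "a 2 + a 3 + a 4 = y" "a 6 + a 7 = y"
    using x[of 1] x[of 5] y[of 3] y[of 7] by (simp_all add: cong_def nbhd_sum_def numeral_2_eq_2)
  have range: "1 \<le> a i \<and> a i \<le> 7" if "1 \<le> i" "i \<le> 7" for i
    using bij_betwE[OF bij] that by auto
  \<comment> \<open>The positions are listed in the order in which \<open>seven_search\<close> lists
    their integers.\<close>
  have "inj_on a (set [2, 1, 4, 6, 5, 3, 7])"
    by (rule inj_on_subset[of a "{1..7}"]) (use bij in \<open>auto simp: bij_betw_def\<close>)
  then have "distinct (map a [2, 1, 4, 6, 5, 3, 7])"
    unfolding distinct_map by simp
  moreover have "a 5 = a 2 + a 1 - a 4 - a 6" "a 7 = a 2 + a 3 + a 4 - a 6"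
    using eqs by linarith+
  ultimately have "a 1 = a 3 + a 4"
    using seven_search[rule_format, of "a 2" "a 1" "a 4" "a 6" "a 3"]
      range[of 1] range[of 2] range[of 3] range[of 4] range[of 5] range[of 6] range[of 7]
    by auto
  with eqs \<open>x \<noteq> y\<close> show False by linarith
qed

section \<open>Combining the residue classes\<close>

theorem theorem1p1:
  "(\<forall>m::nat. m \<ge> 3 \<and> m \<noteq> 7 \<longrightarrow> (\<exists>a. required_perm m a)) \<and>
   \<not> (\<exists>a. required_perm 7 a)"
proof (intro conjI allI impI)
  fix m :: nat
  assume m: "m \<ge> 3 \<and> m \<noteq> 7"
  have "(\<exists>k. int m = 4 * k) \<or> (\<exists>k. int m = 4 * k + 2) \<or> (\<exists>h. int m = 8 * h + 1) \<or>
    (\<exists>h. int m = 8 * h + 3) \<or> (\<exists>h. int m = 8 * h + 5) \<or> (\<exists>h. int m = 8 * h + 7)"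
    by presburger
  then consider k where "int m = 4 * k" | k where "int m = 4 * k + 2"
    | h where "int m = 8 * h + 1" | h where "int m = 8 * h + 3"
    | h where "int m = 8 * h + 5" | h where "int m = 8 * h + 7"
    by blast
  then show "\<exists>a. required_perm m a"
  proof cases
    case (1 k)
    then show ?thesis by (rule ex_required_perm_4k)
  next
    case (2 k)
    then show ?thesis using m by (intro ex_required_perm_4k_2) auto
  next
    case (3 h)
    \<comment> \<open>Here \<open>h = 0\<close> would give \<open>m = 1\<close>, which
      \<open>m \<ge> 3\<close> rules out.\<close>
    with m have "4 \<le> h \<or> m \<in> {9, 17, 25}"
      unfolding insert_iff empty_iff by presburger
    then show ?thesis using 3 ex_required_perm_8h_1 ex_required_perm_small by blast
  next
    case (4 h)
    then show ?thesis by (rule ex_required_perm_8h_3)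
  next
    case (5 h)
    with m have "1 \<le> h \<or> m \<in> {5}"
      unfolding insert_iff empty_iff by presburger
    then show ?thesis using 5 ex_required_perm_8h_5 ex_required_perm_small by blast
  next
    case (6 h)
    \<comment> \<open>Here \<open>h = 0\<close> is exactly the excluded length 7.\<close>
    with m have "3 \<le> h \<or> m \<in> {15, 23}"
      unfolding insert_iff empty_iff by presburger
    then show ?thesis using 6 ex_required_perm_8h_7 ex_required_perm_small by blast
  qed
qed (simp add: not_required_perm_7)

end
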